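(* Let $\alpha_1, A_1, \alpha_2, A_2 > 0$ and consider the system of difference equations $$x_{n+1}=\frac{\alpha_{1}}{A_{1}+y_{n}},\qquad y_{n+1}=\frac{\alpha_{2}}{A_{2}+x_{n}},\qquad n=0,1,2,\dots,$$ with arbitrary nonnegative initial conditions $x_0,y_0$. There is a unique nonnegative equilibrium, and it is globally asymptotically stable.
   Context: The state space is $[0,\infty)^2$. A nonnegative equilibrium is a point $(\bar x,\bar y)\in[0,\infty)^2$ such that the constant sequence $(x_n,y_n)=(\bar x,\bar y)$ solves the system. It is globally asymptotically stable if it is Lyapunov stable relative to $[0,\infty)^2$ (for every $\varepsilon>0$ there is $\delta>0$ such that every initial condition in $[0,\infty)^2$ within $\delta$ of $(\bar x,\bar y)$ has its whole orbit within $\varepsilon$ of $(\bar x,\bar y)$) and every solution with initial condition in $[0,\infty)^2$ converges to $(\bar x,\bar y)$. *)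

theory Defs
  imports "HOL-Analysis.Analysis"
begin

definition state_space :: "(real \<times> real) set"
  where "state_space = {0..} \<times> {0..}"

definition is_solution ::
  "real \<Rightarrow> real \<Rightarrow> real \<Rightarrow> real \<Rightarrow> (nat \<Rightarrow> real \<times> real) \<Rightarrow> bool"
  where "is_solution \<alpha>1 A1 \<alpha>2 A2 z \<longleftrightarrow>
    (\<forall>n. fst (z (Suc n)) = \<alpha>1 / (A1 + snd (z n)) \<and>
         snd (z (Suc n)) = \<alpha>2 / (A2 + fst (z n)))"

definition nonneg_equilibrium ::
  "real \<Rightarrow> real \<Rightarrow> real \<Rightarrow> real \<Rightarrow> real \<times> real \<Rightarrow> bool"
  where "nonneg_equilibrium \<alpha>1 A1 \<alpha>2 A2 p \<longleftrightarrow>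
    p \<in> state_space \<and> is_solution \<alpha>1 A1 \<alpha>2 A2 (\<lambda>n. p)"

definition lyapunov_stable ::
  "real \<Rightarrow> real \<Rightarrow> real \<Rightarrow> real \<Rightarrow> real \<times> real \<Rightarrow> bool"
  where "lyapunov_stable \<alpha>1 A1 \<alpha>2 A2 p \<longleftrightarrow>
    (\<forall>\<epsilon>>0. \<exists>\<delta>>0. \<forall>z. is_solution \<alpha>1 A1 \<alpha>2 A2 z \<longrightarrow> z 0 \<in> state_space \<longrightarrow>
       dist (z 0) p < \<delta> \<longrightarrow> (\<forall>n. dist (z n) p < \<epsilon>))"

definition globally_attracting ::
  "real \<Rightarrow> real \<Rightarrow> real \<Rightarrow> real \<Rightarrow> real \<times> real \<Rightarrow> bool"
  where "globally_attracting \<alpha>1 A1 \<alpha>2 A2 p \<longleftrightarrow>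
    (\<forall>z. is_solution \<alpha>1 A1 \<alpha>2 A2 z \<longrightarrow> z 0 \<in> state_space \<longrightarrow> z \<longlonglongrightarrow> p)"

definition globally_asymptotically_stable ::
  "real \<Rightarrow> real \<Rightarrow> real \<Rightarrow> real \<Rightarrow> real \<times> real \<Rightarrow> bool"
  where "globally_asymptotically_stable \<alpha>1 A1 \<alpha>2 A2 p \<longleftrightarrow>
    lyapunov_stable \<alpha>1 A1 \<alpha>2 A2 p \<and> globally_attracting \<alpha>1 A1 \<alpha>2 A2 p"

end

theory Submission
  imports Defs
begin

text \<open>
  At an equilibrium \<open>(p, q)\<close> one has \<open>\<alpha>1 = p (A1 + q)\<close> and \<open>\<alpha>2 = q (A2 + p)\<close>, so two steps of the
  system give
  \<open>x\<^sub>n\<^sub>+\<^sub>2 - p = p q (x\<^sub>n - p) / (A1 (A2 + x\<^sub>n) + q (A2 + p))\<close>, and symmetrically for \<open>y\<close>. Hence each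
  coordinate's distance to the equilibrium is contracted every two steps by the uniform factor
  \<open>p q / (p q + A1 A2) < 1\<close>, on the whole quadrant.
\<close>

text \<open>Over the common denominator the difference is \<open>p * (q - v) / (A + v)\<close>, and
  \<open>A + v\<close> is at least \<open>A\<close>. The factor \<open>p / A\<close> may exceed 1.
  The bound only serves to control index 1, since the two-step contraction never links indices of
  different parity.\<close>

lemma one_step_bound:
  fixes A p q v :: real
  assumes "A > 0" "p \<ge> 0" "q \<ge> 0" "v \<ge> 0"
  shows "\<bar>p * (A + q) / (A + v) - p\<bar> \<le> p / A * \<bar>v - q\<bar>"
proof -
  have "p * (A + q) / (A + v) - p = p * (q - v) / (A + v)"
    using assms by (simp add: field_simps)
  then have "\<bar>p * (A + q) / (A + v) - p\<bar> = p * \<bar>v - q\<bar> / (A + v)"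
    using assms by (simp add: abs_mult abs_minus_commute)
  also have "\<dots> \<le> p * \<bar>v - q\<bar> / A"
    using assms by (intro divide_left_mono) auto
  finally show ?thesis by simp
qed

lemma two_step_contraction:
  fixes A B p q u :: real
  assumes "A > 0" "B > 0" "p \<ge> 0" "q \<ge> 0" "u \<ge> 0"
  shows "\<bar>p * (A + q) / (A + q * (B + p) / (B + u)) - p\<bar> \<le> p * q / (p * q + A * B) * \<bar>u - p\<bar>"
proof -
  let ?D = "A * (B + u) + q * (B + p)"
  \<comment> \<open>\<open>?D\<close> expands to \<open>A * B + A * u + q * B + p * q\<close>.
    Dropping the two middle terms gives a bound independent of \<open>u\<close>, hence a uniform
    rate.\<close>
  have D: "?D \<ge> p * q + A * B" "p * q + A * B > 0"
    using assms by (simp_all add: algebra_simps add_pos_nonneg)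
  have "A + q * (B + p) / (B + u) = ?D / (B + u)"
    using assms by (simp add: field_simps)
  then have "p * (A + q) / (A + q * (B + p) / (B + u)) - p = p * (A + q) * (B + u) / ?D - p"
    by simp
  also have "\<dots> = (p * (A + q) * (B + u) - p * ?D) / ?D"
    using D by (simp add: diff_divide_distrib)
  \<comment> \<open>The terms \<open>A * (B + u)\<close> cancel, leaving
    \<open>p * (q * (B + u) - q * (B + p))\<close>.\<close>
  also have "\<dots> = p * q * (u - p) / ?D"
    by (simp add: algebra_simps)
  finally have "\<bar>p * (A + q) / (A + q * (B + p) / (B + u)) - p\<bar> = p * q * \<bar>u - p\<bar> / ?D"
    using assms D by (simp add: abs_mult)
  also have "\<dots> \<le> p * q * \<bar>u - p\<bar> / (p * q + A * B)"
    using assms D by (intro divide_left_mono) auto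
  finally show ?thesis by simp
qed

text \<open>Even and odd indices form two independent geometric chains, so \<open>c\<close> has to
  dominate both starting values \<open>E 0\<close> and \<open>E 1\<close>.\<close>

lemma geometric_bound_of_two_step_contraction:
  fixes E :: "nat \<Rightarrow> real"
  assumes "0 \<le> k" and two: "\<And>n. E (Suc (Suc n)) \<le> k * E n"
    and "E 0 \<le> c" "E 1 \<le> c"
  shows "E n \<le> k ^ (n div 2) * c"
proof (induction n rule: induct_nat_012)
  case (ge2 n)
  have "E (Suc (Suc n)) \<le> k * (k ^ (n div 2) * c)"
    using two[of n] mult_left_mono[OF ge2.IH(1) \<open>0 \<le> k\<close>] by linarith
  then show ?case by simp
qed (use assms in auto)

text \<open>Both denominators are positive and can be cleared. In this form \<alpha>1 and \<alpha>2
  can be replaced by expressions in the equilibrium coordinates.\<close>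

lemma nonneg_equilibrium_iff:
  assumes "A1 > 0" "A2 > 0"
  shows "nonneg_equilibrium \<alpha>1 A1 \<alpha>2 A2 (p, q) \<longleftrightarrow>
    p \<ge> 0 \<and> q \<ge> 0 \<and> \<alpha>1 = p * (A1 + q) \<and> \<alpha>2 = q * (A2 + p)"
proof -
  have "A1 + q \<noteq> 0" "A2 + p \<noteq> 0" if "p \<ge> 0" "q \<ge> 0" using assms that by auto
  then show ?thesis
    unfolding nonneg_equilibrium_def is_solution_def state_space_def
    by (auto simp: eq_divide_eq)
qed

text \<open>Eliminating the second coordinate through \<open>\<alpha>2 / (A2 + x)\<close> leaves the
  scalar equation \<open>?f x = \<alpha>1\<close>. Since \<open>?f\<close> vanishes at 0 and is at
  least \<alpha>1 at \<open>\<alpha>1 / A1\<close>, the intermediate value theorem applies.\<close>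

lemma nonneg_equilibrium_exists:
  assumes "\<alpha>1 > 0" "A1 > 0" "\<alpha>2 > 0" "A2 > 0"
  shows "\<exists>p. nonneg_equilibrium \<alpha>1 A1 \<alpha>2 A2 p"
proof -
  let ?f = "\<lambda>x. x * (A1 + \<alpha>2 / (A2 + x))"
  have "\<exists>x\<ge>0. x \<le> \<alpha>1 / A1 \<and> ?f x = \<alpha>1"
  proof (rule IVT')
    show "continuous_on {0..\<alpha>1 / A1} ?f"
      using assms by (auto intro!: continuous_intros)
    have "\<alpha>1 / A1 * A1 \<le> ?f (\<alpha>1 / A1)"
      using assms by (intro mult_left_mono) auto
    then show "\<alpha>1 \<le> ?f (\<alpha>1 / A1)" using assms by simp
  qed (use assms in auto)
  then obtain x where "x \<ge> 0" "?f x = \<alpha>1" by blast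
  moreover from this have "A2 + x > 0" using assms by linarith
  ultimately have "nonneg_equilibrium \<alpha>1 A1 \<alpha>2 A2 (x, \<alpha>2 / (A2 + x))"
    using assms by (simp add: nonneg_equilibrium_iff)
  then show ?thesis ..
qed

lemma solution_in_state_space:
  assumes "\<alpha>1 > 0" "A1 > 0" "\<alpha>2 > 0" "A2 > 0"
    and "is_solution \<alpha>1 A1 \<alpha>2 A2 z" "z 0 \<in> state_space"
  shows "z n \<in> state_space"
  using assms by (induction n) (auto simp: state_space_def is_solution_def mem_Times_iff)

lemma dist_prod_le_sum:
  fixes w p :: "real \<times> real"
  shows "dist w p \<le> \<bar>fst w - fst p\<bar> + \<bar>snd w - snd p\<bar>"
  by (auto simp: dist_prod_def dist_real_def intro: sqrt_sum_squares_le_sum_abs)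

lemma sum_le_twice_dist_prod:
  fixes w p :: "real \<times> real"
  shows "\<bar>fst w - fst p\<bar> + \<bar>snd w - snd p\<bar> \<le> 2 * dist w p"
  using dist_fst_le[of w p] dist_snd_le[of w p] by (simp add: dist_real_def)

text \<open>The rate \<open>k\<close> and the constant \<open>C\<close> are chosen before the
  solution \<open>z\<close>. This uniformity is what lets one estimate yield both stability and
  attraction.\<close>

lemma equilibrium_geometric_attraction:
  assumes pos: "\<alpha>1 > 0" "A1 > 0" "\<alpha>2 > 0" "A2 > 0"
    and eq: "nonneg_equilibrium \<alpha>1 A1 \<alpha>2 A2 e"
  shows "\<exists>k C. 0 \<le> k \<and> k < 1 \<and> C > 0 \<and>
    (\<forall>z n. is_solution \<alpha>1 A1 \<alpha>2 A2 z \<longrightarrow> z 0 \<in> state_space \<longrightarrow>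
      dist (z n) e \<le> k ^ (n div 2) * (C * dist (z 0) e))"
proof -
  obtain p q where e: "e = (p, q)" by (cases e)
  have pq: "p \<ge> 0" "q \<ge> 0" and \<alpha>: "\<alpha>1 = p * (A1 + q)" "\<alpha>2 = q * (A2 + p)"
    using eq pos unfolding e nonneg_equilibrium_iff[OF pos(2,4)] by auto
  define k where "k = p * q / (p * q + A1 * A2)"
  \<comment> \<open>A single constant for both starting values: the summand 1 handles
    \<open>E 0\<close>, and the one-step factors \<open>p / A1\<close> and \<open>q / A2\<close>
    handle \<open>E 1\<close>.\<close>
  define M where "M = 1 + p / A1 + q / A2"
  have "p * q + A1 * A2 > 0" using pos pq by (auto intro: add_nonneg_pos)
  then have k: "0 \<le> k" "k < 1" using pos pq by (auto simp: k_def)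
  have M: "M \<ge> 1" "p / A1 \<le> M" "q / A2 \<le> M" using pos pq by (auto simp: M_def)
  have "dist (z n) e \<le> k ^ (n div 2) * (2 * M * dist (z 0) e)"
    if sol: "is_solution \<alpha>1 A1 \<alpha>2 A2 z" and init: "z 0 \<in> state_space" for z n
  proof -
    define E where "E n = \<bar>fst (z n) - p\<bar> + \<bar>snd (z n) - q\<bar>" for n
    have ge: "fst (z n) \<ge> 0" "snd (z n) \<ge> 0" for n
      using solution_in_state_space[OF pos sol init, of n]
      by (auto simp: state_space_def mem_Times_iff)
    have step: "fst (z (Suc n)) = p * (A1 + q) / (A1 + snd (z n))"
      "snd (z (Suc n)) = q * (A2 + p) / (A2 + fst (z n))" for n
      using sol by (auto simp: is_solution_def \<alpha>)
    \<comment> \<open>The second coordinate uses the same lemma with the roles of the two equations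
      exchanged; \<open>k\<close> is invariant under this exchange.\<close>
    have "E (Suc (Suc n)) \<le> k * E n" for n
      using two_step_contraction[OF pos(2,4) pq ge(1), of n]
        two_step_contraction[OF pos(4,2) pq(2,1) ge(2), of n]
      unfolding E_def step k_def by (simp add: algebra_simps)
    moreover have "E 0 \<le> M * E 0"
      using M mult_right_mono[of 1 M "E 0"] by (simp add: E_def)
    moreover have "E 1 \<le> M * E 0"
    proof -
      have "E 1 \<le> p / A1 * \<bar>snd (z 0) - q\<bar> + q / A2 * \<bar>fst (z 0) - p\<bar>"
        unfolding E_def One_nat_def step
        by (intro add_mono one_step_bound pos pq ge)
      also have "\<dots> \<le> M * \<bar>snd (z 0) - q\<bar> + M * \<bar>fst (z 0) - p\<bar>"
        using M by (intro add_mono mult_right_mono) auto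
      finally show ?thesis by (simp add: E_def algebra_simps)
    qed
    ultimately have "E n \<le> k ^ (n div 2) * (M * E 0)"
      using k by (intro geometric_bound_of_two_step_contraction)
    \<comment> \<open>The factor 2 is the price of passing from the sum of coordinate distances
      \<open>E\<close> to the Euclidean \<open>dist\<close>.\<close>
    also have "\<dots> \<le> k ^ (n div 2) * (M * (2 * dist (z 0) e))"
      using k M sum_le_twice_dist_prod[of "z 0" e]
      by (intro mult_left_mono) (auto simp: E_def e)
    finally show ?thesis
      using dist_prod_le_sum[of "z n" e] by (simp add: E_def e mult_ac)
  qed
  then show ?thesis using k M by (intro exI[of _ k] exI[of _ "2 * M"]) auto
qed

text \<open>In the geometric bound, \<open>k ^ (n div 2) \<le> 1\<close> gives stability with
  \<delta> equal to \<open>\<epsilon> / C\<close>, while \<open>k ^ (n div 2)\<close> tending to 0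
  gives attraction.\<close>

lemma equilibrium_globally_asymptotically_stable:
  assumes pos: "\<alpha>1 > 0" "A1 > 0" "\<alpha>2 > 0" "A2 > 0"
    and eq: "nonneg_equilibrium \<alpha>1 A1 \<alpha>2 A2 e"
  shows "globally_asymptotically_stable \<alpha>1 A1 \<alpha>2 A2 e"
proof -
  obtain k C where k: "0 \<le> k" "k < 1" and C: "C > 0"
    and bound: "\<And>z n. is_solution \<alpha>1 A1 \<alpha>2 A2 z \<Longrightarrow> z 0 \<in> state_space \<Longrightarrow>
      dist (z n) e \<le> k ^ (n div 2) * (C * dist (z 0) e)"
    using equilibrium_geometric_attraction[OF assms] by blast
  have "lyapunov_stable \<alpha>1 A1 \<alpha>2 A2 e"
    unfolding lyapunov_stable_def
  proof (intro allI impI)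
    fix \<epsilon> :: real assume "\<epsilon> > 0"
    have "dist (z n) e < \<epsilon>" if "is_solution \<alpha>1 A1 \<alpha>2 A2 z" "z 0 \<in> state_space"
      "dist (z 0) e < \<epsilon> / C" for z n
    proof -
      have "k ^ (n div 2) * (C * dist (z 0) e) \<le> 1 * (C * dist (z 0) e)"
        using k C by (intro mult_right_mono power_le_one) auto
      moreover have "C * dist (z 0) e < \<epsilon>"
        using that(3) C by (simp add: field_simps)
      ultimately show ?thesis using bound[OF that(1,2), of n] by linarith
    qed
    then show "\<exists>\<delta>>0. \<forall>z. is_solution \<alpha>1 A1 \<alpha>2 A2 z \<longrightarrow> z 0 \<in> state_space \<longrightarrow>
       dist (z 0) e < \<delta> \<longrightarrow> (\<forall>n. dist (z n) e < \<epsilon>)"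
      using \<open>\<epsilon> > 0\<close> C by (intro exI[of _ "\<epsilon> / C"]) auto
  qed
  moreover have "globally_attracting \<alpha>1 A1 \<alpha>2 A2 e"
    unfolding globally_attracting_def
  proof (intro allI impI)
    fix z assume z: "is_solution \<alpha>1 A1 \<alpha>2 A2 z" "z 0 \<in> state_space"
    have "filterlim (\<lambda>n::nat. n div 2) at_top sequentially"
      unfolding filterlim_at_top
    proof
      fix m :: nat
      show "\<forall>\<^sub>F n in sequentially. m \<le> n div 2"
        by (rule eventually_sequentiallyI[of "2 * m"]) linarith
    qed
    then have "(\<lambda>n. k ^ (n div 2)) \<longlonglongrightarrow> 0"
      using filterlim_compose[OF LIMSEQ_realpow_zero[OF k]] by blast
    then have "(\<lambda>n. k ^ (n div 2) * (C * dist (z 0) e)) \<longlonglongrightarrow> 0"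
      by (rule tendsto_mult_left_zero)
    then have "(\<lambda>n. dist (z n) e) \<longlonglongrightarrow> 0"
      by (rule Lim_null_comparison[rotated]) (use bound[OF z] in simp)
    then show "z \<longlonglongrightarrow> e" by (rule tendsto_dist_iff[THEN iffD2])
  qed
  ultimately show ?thesis by (simp add: globally_asymptotically_stable_def)
qed

text \<open>The constant sequence at \<open>p'\<close> is itself a solution, so it must converge to
  \<open>p\<close>. Uniqueness thus follows from attraction, without solving the equilibrium
  equations.\<close>

lemma globally_attracting_equilibria_eq:
  assumes "globally_attracting \<alpha>1 A1 \<alpha>2 A2 p" "nonneg_equilibrium \<alpha>1 A1 \<alpha>2 A2 p'"
  shows "p' = p"
proof -
  have "(\<lambda>n. p') \<longlonglongrightarrow> p"
    using assms by (simp add: globally_attracting_def nonneg_equilibrium_def)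
  then show ?thesis by (simp add: LIMSEQ_const_iff)
qed

theorem theorem9:
  fixes \<alpha>1 A1 \<alpha>2 A2 :: real
  assumes "\<alpha>1 > 0" and "A1 > 0" and "\<alpha>2 > 0" and "A2 > 0"
  shows "(\<exists>!p. nonneg_equilibrium \<alpha>1 A1 \<alpha>2 A2 p) \<and>
    (\<forall>p. nonneg_equilibrium \<alpha>1 A1 \<alpha>2 A2 p \<longrightarrow> globally_asymptotically_stable \<alpha>1 A1 \<alpha>2 A2 p)"
  using nonneg_equilibrium_exists[OF assms] equilibrium_globally_asymptotically_stable[OF assms]
    globally_attracting_equilibria_eq
  unfolding globally_asymptotically_stable_def by blast

end
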